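(* There exist finite Lie conformal algebras $R\subseteq E$ ($R$ a subalgebra of $E$) such that the number of isomorphism classes of complements of $R$ in $E$ is infinite.
   Context: All vector spaces are over $\mathbb{C}$. A Lie conformal algebra is a $\mathbb{C}[\partial]$-module $R$ with a $\mathbb{C}$-bilinear map $[\cdot_\lambda\cdot]: R\times R\to R[\lambda]$ satisfying $[\partial a_\lambda b]=-\lambda[a_\lambda b]$, $[a_\lambda \partial b]=(\partial+\lambda)[a_\lambda b]$, $[a_\lambda b]=-[b_{-\lambda-\partial}a]$ and $[a_\lambda[b_\mu c]]=[[a_\lambda b]_{\lambda+\mu}c]+[b_\mu[a_\lambda c]]$ for all $a,b,c\in R$; here if $[b_\lambda a]=\sum_n\lambda^n w_n$ then $[b_{-\lambda-\partial}a]=\sum_n(-\lambda-\partial)^n w_n$. It is finite if it is finitely generated as a $\mathbb{C}[\partial]$-module. A complement of a subalgebra $R$ in $E$ is a subalgebra $Q$ of $E$ such that $E=R\oplus Q$ as $\mathbb{C}[\partial]$-modules. Isomorphism means isomorphism of Lie conformal algebras (a $\mathbb{C}[\partial]$-module isomorphism preserving $\lambda$-brackets). *)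

theory Defs
  imports "HOL-Algebra.Algebra" "HOL-Computational_Algebra.Polynomial"
begin

text \<open>The ring \<open>\<complex>[\<partial>]\<close> is the type \<^typ>\<open>complex poly\<close>, wrapped as a record so that the
  module locale of HOL-Algebra applies.\<close>

definition Cd_ring :: "complex poly ring" where
  "Cd_ring = \<lparr>carrier = UNIV, monoid.mult = (*), monoid.one = 1, ring.zero = 0, ring.add = (+)\<rparr>"

definition Dd :: "complex poly" where
  "Dd = [:0, 1:]"

text \<open>\<open>lbr E a b n\<close> is the coefficient of \<open>\<lambda>\<^sup>n\<close> in \<open>[a\<^sub>\<lambda> b]\<close>. As for any module record,
  the fields \<open>mult\<close> and \<open>one\<close> are present but carry no meaning.\<close>

record 'a lca = "(complex poly, 'a) module" +
  lbr :: "'a \<Rightarrow> 'a \<Rightarrow> nat \<Rightarrow> 'a"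

text \<open>A finitely generated \<open>\<complex>[\<partial>]\<close>-module has at most continuum many elements, so every finite
  Lie conformal algebra has an isomorphic copy whose carrier is a subset of the type
  \<^typ>\<open>nat \<Rightarrow> complex poly\<close>; existence may thus be stated over that element type.\<close>

text \<open>\<open>M[\<lambda>]\<close>: polynomials in \<open>\<lambda>\<close> with coefficients in \<open>M\<close>, as coefficient sequences.\<close>

definition lam_polys :: "('a, 'm) ring_scheme \<Rightarrow> (nat \<Rightarrow> 'a) set" where
  "lam_polys M = {f. (\<forall>n. f n \<in> carrier M) \<and> finite {n. f n \<noteq> \<zero>\<^bsub>M\<^esub>}}"

text \<open>\<open>\<complex>[\<partial>][\<lambda>]\<close> is \<^typ>\<open>complex poly poly\<close>, the outer variable being \<open>\<lambda>\<close>; thus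
  \<open>[:0, -1:]\<close> is \<open>-\<lambda>\<close>, \<open>[:Dd, 1:]\<close> is \<open>\<partial> + \<lambda>\<close> and \<open>[:-Dd, -1:]\<close> is \<open>-\<lambda> - \<partial>\<close>.
  It acts on \<open>M[\<lambda>]\<close> by the Cauchy product.\<close>

definition lam_act ::
  "(complex poly, 'a, 'm) module_scheme \<Rightarrow> complex poly poly \<Rightarrow> (nat \<Rightarrow> 'a) \<Rightarrow> nat \<Rightarrow> 'a" where
  "lam_act M P f k = (\<Oplus>\<^bsub>M\<^esub>i\<in>{..k}. Polynomial.coeff P i \<odot>\<^bsub>M\<^esub> f (k - i))"

text \<open>For \<open>f = \<Sum>\<^sub>n \<lambda>\<^sup>n w\<^sub>n\<close>, the polynomial \<open>\<Sum>\<^sub>n (-\<lambda> - \<partial>)\<^sup>n w\<^sub>n\<close>.\<close>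

definition lam_flip ::
  "(complex poly, 'a, 'm) module_scheme \<Rightarrow> (nat \<Rightarrow> 'a) \<Rightarrow> nat \<Rightarrow> 'a" where
  "lam_flip M f k =
     (\<Oplus>\<^bsub>M\<^esub>n\<in>{n. f n \<noteq> \<zero>\<^bsub>M\<^esub>}. Polynomial.coeff ([:-Dd, -1:] ^ n) k \<odot>\<^bsub>M\<^esub> f n)"

text \<open>The Jacobi identity is stated for the coefficients of \<open>\<lambda>\<^sup>m \<mu>\<^sup>n\<close>: expanding
  \<open>(\<lambda> + \<mu>)\<^sup>j\<close> in \<open>[[a\<^sub>\<lambda> b]\<^bsub>\<lambda>+\<mu>\<^esub> c] = \<Sum>\<^sub>k \<Sum>\<^sub>j \<lambda>\<^sup>k (\<lambda> + \<mu>)\<^sup>j d\<^sub>k\<^sub>j\<close>, only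
  \<open>j = m - k + n\<close> contributes, with factor \<open>j choose n\<close>.\<close>

locale lie_conformal_algebra = Module.module Cd_ring E for E :: "('a, 'm) lca_scheme" (structure) +
  assumes lbr_closed:
      "\<lbrakk>a \<in> carrier E; b \<in> carrier E\<rbrakk> \<Longrightarrow> lbr E a b \<in> lam_polys E"
    and lbr_add_left:
      "\<lbrakk>a \<in> carrier E; a' \<in> carrier E; b \<in> carrier E\<rbrakk> \<Longrightarrow>
        lbr E (a \<oplus> a') b n = lbr E a b n \<oplus> lbr E a' b n"
    and lbr_add_right:
      "\<lbrakk>a \<in> carrier E; b \<in> carrier E; b' \<in> carrier E\<rbrakk> \<Longrightarrow>
        lbr E a (b \<oplus> b') n = lbr E a b n \<oplus> lbr E a b' n"
    and lbr_scale_left: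
      "\<lbrakk>a \<in> carrier E; b \<in> carrier E\<rbrakk> \<Longrightarrow>
        lbr E ([:z:] \<odot> a) b n = [:z:] \<odot> lbr E a b n"
    and lbr_scale_right:
      "\<lbrakk>a \<in> carrier E; b \<in> carrier E\<rbrakk> \<Longrightarrow>
        lbr E a ([:z:] \<odot> b) n = [:z:] \<odot> lbr E a b n"
    and sesquilinear_left:
      "\<lbrakk>a \<in> carrier E; b \<in> carrier E\<rbrakk> \<Longrightarrow>
        lbr E (Dd \<odot> a) b = lam_act E [:0, -1:] (lbr E a b)"
    and sesquilinear_right:
      "\<lbrakk>a \<in> carrier E; b \<in> carrier E\<rbrakk> \<Longrightarrow>
        lbr E a (Dd \<odot> b) = lam_act E [:Dd, 1:] (lbr E a b)"
    and skew_symmetry: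
      "\<lbrakk>a \<in> carrier E; b \<in> carrier E\<rbrakk> \<Longrightarrow>
        lbr E a b n = \<ominus> lam_flip E (lbr E b a) n"
    and jacobi:
      "\<lbrakk>a \<in> carrier E; b \<in> carrier E; c \<in> carrier E\<rbrakk> \<Longrightarrow>
        lbr E a (lbr E b c n) m =
          (\<Oplus>k\<in>{..m}. of_nat ((m - k + n) choose n) \<odot> lbr E (lbr E a b k) c (m - k + n))
          \<oplus> lbr E b (lbr E a c m) n"

definition finitely_generated :: "(complex poly, 'a, 'm) module_scheme \<Rightarrow> bool" where
  "finitely_generated M \<longleftrightarrow>
     (\<exists>S. finite S \<and> S \<subseteq> carrier M \<and>
        (\<forall>x\<in>carrier M. \<exists>p. x = (\<Oplus>\<^bsub>M\<^esub>s\<in>S. p s \<odot>\<^bsub>M\<^esub> s)))"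

definition finite_lca :: "('a, 'm) lca_scheme \<Rightarrow> bool" where
  "finite_lca E \<longleftrightarrow> lie_conformal_algebra E \<and> finitely_generated E"

definition lca_subalgebra :: "'a set \<Rightarrow> ('a, 'm) lca_scheme \<Rightarrow> bool" where
  "lca_subalgebra H E \<longleftrightarrow>
     submodule H Cd_ring E \<and> (\<forall>a\<in>H. \<forall>b\<in>H. \<forall>n. lbr E a b n \<in> H)"

definition lca_complement :: "'a set \<Rightarrow> 'a set \<Rightarrow> ('a, 'm) lca_scheme \<Rightarrow> bool" where
  "lca_complement Q R E \<longleftrightarrow>
     lca_subalgebra Q E \<and> R <+>\<^bsub>E\<^esub> Q = carrier E \<and> R \<inter> Q = {\<zero>\<^bsub>E\<^esub>}"

definition lca_iso :: "('a, 'm) lca_scheme \<Rightarrow> ('b, 'n) lca_scheme \<Rightarrow> ('a \<Rightarrow> 'b) set" where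
  "lca_iso A B =
     {f \<in> iso (add_monoid A) (add_monoid B).
        (\<forall>p. \<forall>x\<in>carrier A. f (p \<odot>\<^bsub>A\<^esub> x) = p \<odot>\<^bsub>B\<^esub> f x) \<and>
        (\<forall>x\<in>carrier A. \<forall>y\<in>carrier A. \<forall>n. f (lbr A x y n) = lbr B (f x) (f y) n)}"

definition complements :: "'a set \<Rightarrow> ('a, 'm) lca_scheme \<Rightarrow> 'a set set" where
  "complements R E = {Q. lca_complement Q R E}"

definition complement_iso_rel :: "'a set \<Rightarrow> ('a, 'm) lca_scheme \<Rightarrow> ('a set \<times> 'a set) set" where
  "complement_iso_rel R E =
     {(Q, Q'). Q \<in> complements R E \<and> Q' \<in> complements R E \<and>
        lca_iso (E\<lparr>carrier := Q\<rparr>) (E\<lparr>carrier := Q'\<rparr>) \<noteq> {}}"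

end

theory Submission
  imports Defs
begin

text \<open>
  Take \<open>E = \<complex>[\<partial>] v \<oplus> \<complex>[\<partial>] r \<oplus> \<complex> z\<close> with \<open>\<partial> z = 0\<close>, where \<open>z\<close> is central,
  \<open>[v\<^sub>\<lambda> v] = [r\<^sub>\<lambda> r] = 0\<close> and \<open>[v\<^sub>\<lambda> r] = [r\<^sub>\<lambda> v] = \<lambda> z\<close>. All brackets lie in the
  centre, so the Jacobi identity is \<open>0 = 0\<close>. Because \<open>\<partial> z = 0\<close>, sesquilinearity gives
  \<open>[a(\<partial>) v\<^sub>\<lambda> b(\<partial>) r] = a(-\<lambda>) b(\<lambda>) \<lambda> z\<close>, and skew-symmetry only asks the polynomial in front of
  \<open>z\<close> to be odd under swapping the arguments and replacing \<open>\<lambda>\<close> by \<open>-\<lambda>\<close>.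

  Let \<open>R = \<complex>[\<partial>] r\<close>. It is a subalgebra but not an ideal, and tilting \<open>v\<close> along \<open>R\<close> changes
  the bracket of a complement: for every \<open>n\<close> the element \<open>v\<^sub>n = v + \<partial>\<^sup>2\<^sup>n r\<close> satisfies
  \<open>[v\<^sub>n \<^sub>\<lambda> v\<^sub>n] = 2 \<lambda>\<^sup>2\<^sup>n\<^sup>+\<^sup>1 z\<close>, so \<open>Q\<^sub>n = \<complex>[\<partial>] v\<^sub>n \<oplus> \<complex> z\<close> is a complement of \<open>R\<close>.
  (An odd power of \<open>\<partial>\<close> would give the zero bracket.)
  The least power of \<open>\<lambda>\<close> occurring in the brackets of \<open>Q\<^sub>n\<close> is \<open>2n + 1\<close>, since every bracket
  in \<open>Q\<^sub>n\<close> is a multiple of \<open>\<lambda>\<^sup>2\<^sup>n\<^sup>+\<^sup>1 z\<close>; hence the \<open>Q\<^sub>n\<close> are pairwise non-isomorphic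
  (\<open>tilt_not_iso\<close>).
\<close>

section \<open>The algebra and its subalgebras\<close>

text \<open>\<open>triple p q c\<close> stands for \<open>p v + q r + c z\<close>.\<close>

definition triple :: "complex poly \<Rightarrow> complex poly \<Rightarrow> complex \<Rightarrow> nat \<Rightarrow> complex poly" where
  "triple p q c = (\<lambda>i. if i = 0 then p else if i = 1 then q else if i = 2 then [:c:] else 0)"

definition triples :: "(nat \<Rightarrow> complex poly) set" where
  "triples = {triple p q c | p q c. True}"

definition vadd :: "(nat \<Rightarrow> complex poly) \<Rightarrow> (nat \<Rightarrow> complex poly) \<Rightarrow> nat \<Rightarrow> complex poly" where
  "vadd a b = (\<lambda>i. a i + b i)"

definition vscale :: "complex poly \<Rightarrow> (nat \<Rightarrow> complex poly) \<Rightarrow> nat \<Rightarrow> complex poly" where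
  "vscale p a = (\<lambda>i. if i = 2 then Polynomial.smult (poly p 0) (a 2) else p * a i)"

definition reflect :: "complex poly \<Rightarrow> complex poly" where
  "reflect p = pcompose p [:0, -1:]"

text \<open>The coefficient of \<open>z\<close> in the \<open>\<lambda>\<close>-bracket, as a polynomial in \<open>\<lambda>\<close>.\<close>

definition bracket_poly ::
  "(nat \<Rightarrow> complex poly) \<Rightarrow> (nat \<Rightarrow> complex poly) \<Rightarrow> complex poly" where
  "bracket_poly a b = [:0, 1:] * (reflect (a 0) * b 1 + reflect (a 1) * b 0)"

definition bracket ::
  "(nat \<Rightarrow> complex poly) \<Rightarrow> (nat \<Rightarrow> complex poly) \<Rightarrow> nat \<Rightarrow> nat \<Rightarrow> complex poly" where
  "bracket a b n = triple 0 0 (Polynomial.coeff (bracket_poly a b) n)"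

text \<open>The carrier is a parameter so that the Lie conformal algebra axioms are checked once, for
  the whole algebra and for \<open>R\<close> simultaneously.\<close>

definition alg :: "(nat \<Rightarrow> complex poly) set \<Rightarrow> (nat \<Rightarrow> complex poly) lca" where
  "alg S = \<lparr>carrier = S, monoid.mult = undefined, monoid.one = undefined,
     ring.zero = (\<lambda>_. 0), ring.add = vadd, module.smult = vscale, lbr = bracket\<rparr>"

lemma alg_simps [simp]:
  "carrier (alg S) = S" "ring.zero (alg S) = (\<lambda>_. 0)" "ring.add (alg S) = vadd"
  "module.smult (alg S) = vscale" "lbr (alg S) = bracket"
  by (simp_all add: alg_def)

lemma alg_carrier_update [simp]: "alg S\<lparr>carrier := S'\<rparr> = alg S'"
  by (simp add: alg_def)

lemma triple_nth [simp]:
  "triple p q c 0 = p" "triple p q c (Suc 0) = q" "triple p q c 2 = [:c:]"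
  by (simp_all add: triple_def)

lemma triple_eq_iff [simp]: "triple p q c = triple p' q' c' \<longleftrightarrow> p = p' \<and> q = q' \<and> c = c'"
  by (metis triple_nth pCons_eq_iff)

lemma zero_triple: "(\<lambda>_. 0) = triple 0 0 0"
  by (auto simp: triple_def)

lemma triple_eq_zero_iff [simp]: "triple p q c = (\<lambda>_. 0) \<longleftrightarrow> p = 0 \<and> q = 0 \<and> c = 0"
  by (simp add: zero_triple)

lemma triple_in_triples [simp]: "triple p q c \<in> triples"
  by (auto simp: triples_def)

lemma triplesE:
  assumes "a \<in> triples"
  obtains p q c where "a = triple p q c"
  using assms by (auto simp: triples_def)

lemma vadd_triple [simp]:
  "vadd (triple p q c) (triple p' q' c') = triple (p + p') (q + q') (c + c')"
  by (auto simp: vadd_def triple_def)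

lemma vscale_triple [simp]:
  "vscale k (triple p q c) = triple (k * p) (k * q) (poly k 0 * c)"
  by (auto simp: vscale_def triple_def)

lemma reflect_simps [simp]:
  "reflect 0 = 0" "reflect 1 = 1" "reflect (p + q) = reflect p + reflect q"
  "reflect (p * q) = reflect p * reflect q" "reflect (Polynomial.smult c p) = Polynomial.smult c (reflect p)"
  "reflect (pCons c p) = [:c:] - [:0, 1:] * reflect p" "reflect (reflect p) = p"
  by (simp_all add: reflect_def pcompose_add pcompose_mult pcompose_smult pcompose_pCons pcompose_1
      flip: pcompose_assoc)

lemma coeff_reflect: "Polynomial.coeff (reflect p) n = (-1) ^ n * Polynomial.coeff p n"
  by (simp add: reflect_def coeff_pcompose_linear)

lemma reflect_monom_even: "reflect (Polynomial.monom 1 (2 * n)) = Polynomial.monom 1 (2 * n)"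
  by (rule poly_eqI) (auto simp: coeff_reflect)

lemma bracket_poly_swap: "bracket_poly a b = - reflect (bracket_poly b a)"
  by (simp add: bracket_poly_def algebra_simps)

lemma bracket_poly_vadd:
  "bracket_poly (vadd a a') b = bracket_poly a b + bracket_poly a' b"
  "bracket_poly a (vadd b b') = bracket_poly a b + bracket_poly a b'"
  by (simp_all add: bracket_poly_def vadd_def algebra_simps del: mult_pCons_left mult_pCons_right)

lemma bracket_poly_vscale:
  "bracket_poly (vscale p a) b = reflect p * bracket_poly a b"
  "bracket_poly a (vscale p b) = p * bracket_poly a b"
  by (simp_all add: bracket_poly_def vscale_def algebra_simps del: mult_pCons_left mult_pCons_right)

lemma bracket_poly_central [simp]:
  "bracket_poly (triple 0 0 c) a = 0" "bracket_poly a (triple 0 0 c) = 0"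
  by (simp_all add: bracket_poly_def)

lemma bracket_triple_central [simp]:
  "bracket (triple 0 0 c) a n = triple 0 0 0" "bracket a (triple 0 0 c) n = triple 0 0 0"
  by (simp_all add: bracket_def)

lemma bracket_central:
  "bracket a (bracket b c n) m = triple 0 0 0"
  "bracket (bracket a b n) c m = triple 0 0 0"
  by (simp_all add: bracket_def[of _ _ n] bracket_def[of a b n])

text \<open>Since \<open>\<partial>\<close> kills \<open>z\<close>, the substitution \<open>\<lambda> \<mapsto> -\<lambda> - \<partial>\<close> acts on \<open>\<complex>[\<lambda>] z\<close> as
  \<open>\<lambda> \<mapsto> -\<lambda>\<close>.\<close>

lemma flip_power_at_zero:
  "poly (Polynomial.coeff ([:-Dd, -1:] ^ n) k) 0 = (if k = n then (-1) ^ n else 0)"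
proof (induction n arbitrary: k)
  case 0
  then show ?case by (cases k) auto
next
  case (Suc n)
  then show ?case by (cases k) (auto simp: Dd_def)
qed

lemma cring_Cd: "cring Cd_ring"
proof (rule cringI)
  show "abelian_group Cd_ring"
  proof (rule abelian_groupI)
    fix x assume "x \<in> carrier Cd_ring"
    show "\<exists>y\<in>carrier Cd_ring. y \<oplus>\<^bsub>Cd_ring\<^esub> x = \<zero>\<^bsub>Cd_ring\<^esub>"
      by (rule bexI[of _ "- x"]) (auto simp: Cd_ring_def)
  qed (auto simp: Cd_ring_def algebra_simps)
  show "comm_monoid Cd_ring"
    by (rule comm_monoidI) (auto simp: Cd_ring_def algebra_simps)
qed (auto simp: Cd_ring_def algebra_simps)

locale closed_carrier =
  fixes S :: "(nat \<Rightarrow> complex poly) set"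
  assumes sub: "S \<subseteq> triples"
    and zero_mem: "triple 0 0 0 \<in> S"
    and add_mem: "a \<in> S \<Longrightarrow> b \<in> S \<Longrightarrow> vadd a b \<in> S"
    and scale_mem: "a \<in> S \<Longrightarrow> vscale p a \<in> S"
    and bracket_mem: "a \<in> S \<Longrightarrow> b \<in> S \<Longrightarrow> bracket a b n \<in> S"
begin

lemma mem_triple:
  assumes "a \<in> S"
  obtains p q c where "a = triple p q c"
  using assms sub triplesE by blast

lemma abelian_group_alg: "abelian_group (alg S)"
proof (rule abelian_groupI)
  fix x assume "x \<in> carrier (alg S)"
  then have x: "x \<in> S" by simp
  have "vadd (vscale [:-1:] x) x = (\<lambda>_. 0)"
    using x by (auto elim!: mem_triple)
  then show "\<exists>y\<in>carrier (alg S). y \<oplus>\<^bsub>alg S\<^esub> x = \<zero>\<^bsub>alg S\<^esub>"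
    using scale_mem[OF x] by auto
qed (use zero_mem add_mem in \<open>auto simp: vadd_def zero_triple[symmetric] algebra_simps\<close>)

lemma module_alg: "Module.module Cd_ring (alg S)"
proof (rule Module.moduleI[OF cring_Cd abelian_group_alg])
qed (auto simp: Cd_ring_def scale_mem elim!: mem_triple simp: algebra_simps)

lemma finsum_alg:
  assumes "f \<in> A \<rightarrow> S"
  shows "finsum (alg S) f A = (\<lambda>i. \<Sum>x\<in>A. f x i)"
proof -
  interpret abelian_group "alg S" by (rule abelian_group_alg)
  show ?thesis
  proof (cases "finite A")
    case True
    then show ?thesis
      using assms by (induction A) (auto simp: vadd_def)
  next
    case False
    then show ?thesis by (simp add: finsum_infinite)
  qed
qed

lemma a_inv_alg:
  assumes "a \<in> S"
  shows "\<ominus>\<^bsub>alg S\<^esub> a = vscale [:-1:] a"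
proof -
  interpret abelian_group "alg S" by (rule abelian_group_alg)
  show ?thesis
    by (rule minus_equality) (use assms scale_mem in \<open>auto elim!: mem_triple\<close>)
qed

lemma finsum_central:
  assumes "\<And>x. x \<in> A \<Longrightarrow> triple 0 0 (g x) \<in> S"
  shows "finsum (alg S) (\<lambda>x. triple 0 0 (g x)) A = triple 0 0 (\<Sum>x\<in>A. g x)"
proof -
  have "[:\<Sum>x\<in>A. g x:] = (\<Sum>x\<in>A. [:g x:])"
    by (rule poly_eqI) (auto simp: coeff_sum coeff_pCons split: nat.splits)
  then show ?thesis
    using assms by (subst finsum_alg) (auto simp: triple_def fun_eq_iff)
qed

lemma central_mem:
  assumes "a \<in> S" "b \<in> S"
  shows "triple 0 0 (k * Polynomial.coeff (bracket_poly a b) n) \<in> S"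
  using scale_mem[OF bracket_mem[OF assms, of n], of "[:k:]"] by (simp add: bracket_def)

text \<open>The action of \<open>\<complex>[\<partial>][\<lambda>]\<close> on \<open>\<complex>[\<lambda>] z\<close> factors through \<open>\<partial> \<mapsto> 0\<close>.\<close>

lemma lam_act_bracket:
  assumes "a \<in> S" "b \<in> S"
  shows "lam_act (alg S) P (bracket a b) k =
    triple 0 0 (Polynomial.coeff (map_poly (\<lambda>p. poly p 0) P * bracket_poly a b) k)"
  unfolding lam_act_def alg_simps bracket_def vscale_triple mult_zero_right
  by (subst finsum_central) (auto intro: central_mem[OF assms] simp: coeff_mult coeff_map_poly)

lemma lam_flip_bracket:
  assumes "a \<in> S" "b \<in> S"
  shows "lam_flip (alg S) (bracket a b) k =
    triple 0 0 ((-1) ^ k * Polynomial.coeff (bracket_poly a b) k)"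
proof -
  let ?c = "Polynomial.coeff (bracket_poly a b)"
  have fin: "finite {n. ?c n \<noteq> 0}"
    using MOST_coeff_eq_0[of "bracket_poly a b"] by (simp add: MOST_iff_cofinite)
  have "lam_flip (alg S) (bracket a b) k =
      triple 0 0 (\<Sum>n | ?c n \<noteq> 0. poly (Polynomial.coeff ([:-Dd, -1:] ^ n) k) 0 * ?c n)"
    unfolding lam_flip_def alg_simps bracket_def vscale_triple mult_zero_right triple_eq_zero_iff
      simp_thms
    by (rule finsum_central) (rule central_mem[OF assms])
  also have "(\<Sum>n | ?c n \<noteq> 0. poly (Polynomial.coeff ([:-Dd, -1:] ^ n) k) 0 * ?c n) =
      (\<Sum>n | ?c n \<noteq> 0. if n = k then (-1) ^ k * ?c k else 0)"
    by (rule sum.cong) (auto simp: flip_power_at_zero)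
  also have "\<dots> = (-1) ^ k * ?c k"
    using fin by (auto simp: sum.delta')
  finally show ?thesis .
qed

lemma lie_conformal_algebra_alg: "lie_conformal_algebra (alg S)"
proof -
  interpret M: Module.module Cd_ring "alg S" by (rule module_alg)
  show ?thesis
  proof (unfold_locales, goal_cases)
    case (1 a b)
    have "finite {n. Polynomial.coeff (bracket_poly a b) n \<noteq> 0}"
      using MOST_coeff_eq_0[of "bracket_poly a b"] by (simp add: MOST_iff_cofinite)
    then have "finite {n. bracket a b n \<noteq> (\<lambda>_. 0)}"
      by (simp add: bracket_def)
    then show ?case using 1 by (simp add: lam_polys_def bracket_mem)
  next
    case (2 a a' b n)
    show ?case by (simp add: bracket_def bracket_poly_vadd)
  next
    case (3 a b b' n)
    show ?case by (simp add: bracket_def bracket_poly_vadd)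
  next
    case (4 a b z n)
    show ?case by (simp add: bracket_def bracket_poly_vscale)
  next
    case (5 a b z n)
    show ?case by (simp add: bracket_def bracket_poly_vscale)
  next
    case (6 a b)
    then show ?case
      by (intro ext) (simp add: lam_act_bracket bracket_def bracket_poly_vscale Dd_def
          map_poly_pCons)
  next
    case (7 a b)
    then show ?case
      by (intro ext) (simp add: lam_act_bracket bracket_def bracket_poly_vscale Dd_def
          map_poly_pCons)
  next
    case (8 a b n)
    then have "lbr (alg S) a b n = vscale [:-1:] (lam_flip (alg S) (bracket b a) n)"
      by (simp add: lam_flip_bracket bracket_def bracket_poly_swap[of a b] coeff_reflect)
    moreover have "lam_flip (alg S) (bracket b a) n \<in> S"
      using 8 central_mem[of b a] by (simp add: lam_flip_bracket)
    ultimately show ?case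
      by (simp add: a_inv_alg)
  next
    case (9 a b c n m)
    then show ?case
      using finsum_central[of "{..m}" "\<lambda>_. 0"] zero_mem by (simp add: bracket_central)
  qed
qed

end

lemma closed_carrier_triples: "closed_carrier triples"
  by unfold_locales (auto elim!: triplesE simp: bracket_def)

section \<open>The subalgebra and its complements\<close>

text \<open>\<open>base\<close> is \<open>R\<close> and \<open>tilt n\<close> is \<open>Q\<^sub>n = \<complex>[\<partial>] (v + \<partial>\<^sup>2\<^sup>n r) \<oplus> \<complex> z\<close>.\<close>

definition base :: "(nat \<Rightarrow> complex poly) set" where
  "base = {triple 0 q 0 | q. True}"

definition tilt :: "nat \<Rightarrow> (nat \<Rightarrow> complex poly) set" where
  "tilt n = {triple p (Polynomial.monom 1 (2 * n) * p) c | p c. True}"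

lemma closed_carrier_base: "closed_carrier base"
  by unfold_locales (auto simp: base_def bracket_def bracket_poly_def)

lemma closed_carrier_tilt: "closed_carrier (tilt n)"
  by unfold_locales (auto simp: tilt_def bracket_def algebra_simps)

lemma lca_subalgebra_alg:
  assumes "closed_carrier S"
  shows "lca_subalgebra S (alg triples)"
proof -
  interpret S: closed_carrier S by fact
  interpret T: closed_carrier triples by (rule closed_carrier_triples)
  interpret G: abelian_group "alg triples" by (rule T.abelian_group_alg)
  have "subgroup S (add_monoid (alg triples))"
  proof (rule G.add.subgroupI)
    fix a assume "a \<in> S"
    then show "\<ominus>\<^bsub>alg triples\<^esub> a \<in> S"
      using S.sub S.scale_mem by (auto simp: T.a_inv_alg)
  qed (use S.sub S.zero_mem S.add_mem in auto)
  then have "submodule S Cd_ring (alg triples)"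
    by (simp add: submodule_def submodule_axioms_def S.scale_mem)
  then show ?thesis
    by (simp add: lca_subalgebra_def S.bracket_mem)
qed

lemma finitely_generated_triples: "finitely_generated (alg triples)"
proof -
  interpret T: closed_carrier triples by (rule closed_carrier_triples)
  let ?v = "triple 1 0 0" and ?r = "triple 0 1 0" and ?z = "triple 0 0 1"
  show ?thesis
    unfolding finitely_generated_def
  proof (intro exI[of _ "{?v, ?r, ?z}"] conjI ballI)
    fix x assume "x \<in> carrier (alg triples)"
    then obtain p q c where x: "x = triple p q c" by (auto elim: triplesE)
    define k where "k s = (if s = ?v then p else if s = ?r then q else [:c:])" for s
    have "(\<Oplus>\<^bsub>alg triples\<^esub>s\<in>{?v, ?r, ?z}. k s \<odot>\<^bsub>alg triples\<^esub> s) =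
        (\<lambda>i. \<Sum>s\<in>{?v, ?r, ?z}. vscale (k s) s i)"
      unfolding alg_simps by (rule T.finsum_alg) (auto intro!: T.scale_mem)
    also have "\<dots> = vadd (vscale p ?v) (vadd (vscale q ?r) (vscale [:c:] ?z))"
      by (simp add: k_def vadd_def del: vscale_triple vadd_triple)
    also have "\<dots> = x"
      by (simp add: x)
    finally show "\<exists>k. x = (\<Oplus>\<^bsub>alg triples\<^esub>s\<in>{?v, ?r, ?z}. k s \<odot>\<^bsub>alg triples\<^esub> s)"
      by (intro exI[of _ k]) (rule sym)
  qed simp_all
qed

lemma finitely_generated_base: "finitely_generated (alg base)"
proof -
  interpret B: closed_carrier base by (rule closed_carrier_base)
  let ?r = "triple 0 1 0"
  have r: "?r \<in> base" by (auto simp: base_def)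
  show ?thesis
    unfolding finitely_generated_def
  proof (intro exI[of _ "{?r}"] conjI ballI)
    fix x assume "x \<in> carrier (alg base)"
    then obtain q where x: "x = triple 0 q 0" by (auto simp: base_def)
    have "(\<Oplus>\<^bsub>alg base\<^esub>s\<in>{?r}. q \<odot>\<^bsub>alg base\<^esub> s) = (\<lambda>i. \<Sum>s\<in>{?r}. vscale q s i)"
      unfolding alg_simps by (rule B.finsum_alg) (auto simp: base_def)
    also have "\<dots> = x"
      by (simp add: x)
    finally show "\<exists>k. x = (\<Oplus>\<^bsub>alg base\<^esub>s\<in>{?r}. k s \<odot>\<^bsub>alg base\<^esub> s)"
      by (intro exI[of _ "\<lambda>_. q"]) (rule sym)
  qed (use r in simp_all)
qed

lemma tilt_complement: "tilt n \<in> complements base (alg triples)"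
proof -
  have "base <+>\<^bsub>alg triples\<^esub> tilt n = triples"
  proof (intro equalityI subsetI)
    fix x assume "x \<in> triples"
    then obtain p q c where x: "x = triple p q c" by (rule triplesE)
    let ?m = "Polynomial.monom 1 (2 * n) * p"
    have "x = vadd (triple 0 (q - ?m) 0) (triple p ?m c)" by (simp add: x)
    moreover have "triple 0 (q - ?m) 0 \<in> base" "triple p ?m c \<in> tilt n"
      by (auto simp: base_def tilt_def)
    ultimately show "x \<in> base <+>\<^bsub>alg triples\<^esub> tilt n"
      unfolding set_add_def' alg_simps by blast
  next
    fix x assume "x \<in> base <+>\<^bsub>alg triples\<^esub> tilt n"
    then show "x \<in> triples"
      unfolding set_add_def' alg_simps base_def tilt_def by auto
  qed
  moreover have "base \<inter> tilt n = {triple 0 0 0}"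
    by (auto simp: base_def tilt_def)
  ultimately show ?thesis
    using lca_subalgebra_alg[OF closed_carrier_tilt]
    by (simp add: complements_def lca_complement_def zero_triple)
qed

text \<open>The coefficient of \<open>\<lambda>\<^sup>2\<^sup>n\<^sup>+\<^sup>1\<close> in \<open>[v\<^sub>n \<^sub>\<lambda> v\<^sub>n]\<close> is \<open>2 z\<close>, whereas for
  \<open>m > n\<close> this coefficient vanishes in every bracket of \<open>Q\<^sub>m\<close>; a bracket-preserving linear map
  \<open>Q\<^sub>n \<rightarrow> Q\<^sub>m\<close> therefore kills \<open>z\<close>.\<close>

lemma tilt_not_iso:
  assumes "n < m"
  shows "lca_iso (alg (tilt n)) (alg (tilt m)) = {}"
proof (rule ccontr)
  assume "lca_iso (alg (tilt n)) (alg (tilt m)) \<noteq> {}"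
  then obtain f where f: "f \<in> lca_iso (alg (tilt n)) (alg (tilt m))" by blast
  from f have inj: "inj_on f (tilt n)" and maps: "\<And>x. x \<in> tilt n \<Longrightarrow> f x \<in> tilt m"
    by (auto simp: lca_iso_def iso_def bij_betw_def)
  from f have scale: "\<And>p x. x \<in> tilt n \<Longrightarrow> f (vscale p x) = vscale p (f x)"
    and br: "\<And>x y k. x \<in> tilt n \<Longrightarrow> y \<in> tilt n \<Longrightarrow> f (bracket x y k) = bracket (f x) (f y) k"
    by (auto simp: lca_iso_def)
  let ?v = "triple 1 (Polynomial.monom 1 (2 * n)) 0"
  have v: "?v \<in> tilt n" and z: "triple 0 0 2 \<in> tilt n" and 0: "triple 0 0 0 \<in> tilt n"
    by (auto simp: tilt_def)
  have "bracket ?v ?v (2 * n + 1) = triple 0 0 2"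
    by (simp add: bracket_def bracket_poly_def reflect_monom_even numeral_mult_conv_smult)
  then have fz: "f (triple 0 0 2) = bracket (f ?v) (f ?v) (2 * n + 1)"
    using br[OF v v] by metis
  obtain p c where fv: "f ?v = triple p (Polynomial.monom 1 (2 * m) * p) c"
    using maps[OF v] by (auto simp: tilt_def)
  have "bracket_poly (f ?v) (f ?v) =
      Polynomial.monom 1 (2 * m) * ([:0, 1:] * (2 * reflect p * p))"
    unfolding fv by (simp add: bracket_poly_def reflect_monom_even)
  then have "Polynomial.coeff (bracket_poly (f ?v) (f ?v)) (2 * n + 1) = 0"
    using assms by (simp add: coeff_monom_mult)
  then have "f (triple 0 0 2) = triple 0 0 0"
    by (simp add: fz bracket_def)
  moreover have "f (triple 0 0 0) = triple 0 0 0"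
    using scale[OF 0, of 0] maps[OF 0] by (auto simp: tilt_def)
  ultimately have "triple 0 0 2 = triple 0 0 0"
    using inj_onD[OF inj _ z 0] by metis
  then show False by simp
qed

theorem mainTheorem5:
  shows "\<exists>(E :: (nat \<Rightarrow> complex poly) lca) R.
    finite_lca E \<and> lca_subalgebra R E \<and> finite_lca (E\<lparr>carrier := R\<rparr>) \<and>
    infinite (complements R E // complement_iso_rel R E)"
proof (intro exI conjI)
  let ?C = "complements base (alg triples)" and ?r = "complement_iso_rel base (alg triples)"
  show "finite_lca (alg triples)"
    by (simp add: finite_lca_def finitely_generated_triples
        closed_carrier.lie_conformal_algebra_alg closed_carrier_triples)
  show "lca_subalgebra base (alg triples)"
    by (rule lca_subalgebra_alg) (rule closed_carrier_base)
  show "finite_lca (alg triples\<lparr>carrier := base\<rparr>)"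
    by (simp add: finite_lca_def finitely_generated_base
        closed_carrier.lie_conformal_algebra_alg closed_carrier_base)
  have refl: "(tilt n, tilt n) \<in> ?r" for n
  proof -
    have "id \<in> lca_iso (alg (tilt n)) (alg (tilt n))"
      by (auto simp: lca_iso_def iso_def hom_def)
    then show ?thesis by (auto simp: complement_iso_rel_def tilt_complement)
  qed
  \<comment> \<open>One direction suffices: were the classes equal, reflexivity would put \<open>tilt m\<close> into the
    class of \<open>tilt n\<close>.\<close>
  have "?r `` {tilt n} \<noteq> ?r `` {tilt m}" if "n < m" for n m
    using refl[of m] tilt_not_iso[OF that] by (auto simp: complement_iso_rel_def)
  then have "inj (\<lambda>n. ?r `` {tilt n})"
    by (intro injI) (metis linorder_neqE_nat)
  then have "infinite (range (\<lambda>n. ?r `` {tilt n}))"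
    by (rule range_inj_infinite)
  moreover have "range (\<lambda>n. ?r `` {tilt n}) \<subseteq> ?C // ?r"
    by (auto intro!: quotientI tilt_complement)
  ultimately show "infinite (?C // ?r)"
    using infinite_super by blast
qed

end
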